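(* Let $\Omega_n^{\{1,3\}}(\tau)$ denote the set of permutations $\pi\in S_n$ that avoid $\tau$ and whose order in the group $S_n$ is $1$ or $3$. Then \[\sum_{n\ge1}\big|\Omega_n^{\{1,3\}}(231)\big|x^n=\sum_{n\ge1}\big|\Omega_n^{\{1,3\}}(312)\big|x^n=\frac{x+x^3+x^5}{1-x-3x^3-x^5}.\]
   Context: Permutations $\pi\in S_n$ are identified with words $\pi(1)\cdots\pi(n)$. For $\tau\in S_m$, entries $\pi(i_1),\ldots,\pi(i_m)$ with $i_1<\cdots<i_m$ form an occurrence of $\tau$ if for all $j,l$, $\pi(i_j)<\pi(i_l)$ iff $\tau(j)<\tau(l)$; $\pi$ avoids $\tau$ if there is no occurrence. *)

theory Defs
  imports
    "HOL-Algebra.Sym_Groups"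
    "HOL-Algebra.Multiplicative_Group"
    "HOL-Computational_Algebra.Formal_Power_Series"
begin

(* A word w(1)...w(m) is read as the permutation of {1..m} with one-line notation w; as usual
   for elements of sym_group, it is extended by the identity outside {1..m}. *)
definition perm_of_word :: "nat list \<Rightarrow> nat \<Rightarrow> nat" where
  "perm_of_word w i = (if i \<in> {1..length w} then w ! (i - 1) else i)"

(* The positions i(1) < ... < i(m) are given by a function i on {1..m};
   pi is in S_n and tau is in S_m. *)
definition is_occurrence ::
    "nat \<Rightarrow> (nat \<Rightarrow> nat) \<Rightarrow> nat \<Rightarrow> (nat \<Rightarrow> nat) \<Rightarrow> (nat \<Rightarrow> nat) \<Rightarrow> bool" where
  "is_occurrence n \<pi> m \<tau> i \<longleftrightarrow>
     i ` {1..m} \<subseteq> {1..n} \<and> strict_mono_on {1..m} i \<and>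
     (\<forall>j\<in>{1..m}. \<forall>l\<in>{1..m}. \<pi> (i j) < \<pi> (i l) \<longleftrightarrow> \<tau> j < \<tau> l)"

definition avoids :: "nat \<Rightarrow> (nat \<Rightarrow> nat) \<Rightarrow> nat \<Rightarrow> (nat \<Rightarrow> nat) \<Rightarrow> bool" where
  "avoids n \<pi> m \<tau> \<longleftrightarrow> \<not> (\<exists>i. is_occurrence n \<pi> m \<tau> i)"

definition Omega :: "nat set \<Rightarrow> nat \<Rightarrow> nat list \<Rightarrow> (nat \<Rightarrow> nat) set" where
  "Omega K n w = {\<pi> \<in> carrier (sym_group n).
     avoids n \<pi> (length w) (perm_of_word w) \<and> group.ord (sym_group n) \<pi> \<in> K}"

(* The formal power series with terms a(n) x^n over n >= 1 only: the constant term is 0. *)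
definition gen_fun :: "(nat \<Rightarrow> nat) \<Rightarrow> rat fps" where
  "gen_fun a = Abs_fps (\<lambda>n. if n \<ge> 1 then of_nat (a n) else 0)"

lemma perm_of_word_231: "perm_of_word [2, 3, 1] permutes {1..3}"
  and perm_of_word_312: "perm_of_word [3, 1, 2] permutes {1..3}"
proof -
  have *: "{1..3} = {1, 2, 3::nat}"
    by auto
  show "perm_of_word [2, 3, 1] permutes {1..3}"
    by (rule bij_imp_permutes; unfold *) (auto simp: bij_betw_def perm_of_word_def)
  show "perm_of_word [3, 1, 2] permutes {1..3}"
    by (rule bij_imp_permutes; unfold *) (auto simp: bij_betw_def perm_of_word_def)
qed

end

theory Submission
  imports Defs
begin

text \<open>
  Inversion exchanges the patterns 231 and 312, so it suffices to count the 312-avoiders \<open>p\<close> with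
  \<open>p\<^sup>3 = id\<close>. Such a \<open>p\<close> splits, right after the entry 1, into a direct sum of
  an indecomposable one (ending in 1) and an arbitrary one, so the generating functions satisfy
  \<open>T = 1 + C T\<close>. An indecomposable one of size \<open>m + 3\<close> contains a cycle
  \<open>1 \<mapsto> a + 2 \<mapsto> m + 3 \<mapsto> 1\<close>. Deleting it leaves a 312-avoider \<open>r\<close> of size \<open>m\<close> whose
  values at most \<open>a\<close> appear in decreasing order and whose entries at positions beyond \<open>a\<close>
  decrease. If \<open>r\<close> is indecomposable, this holds exactly for \<open>a = r 1\<close> and \<open>a = r 1 - 1\<close>;
  the only other possibilities are the empty permutation and \<open>r = 12\<close> with \<open>a = 1\<close>. Hence
  \<open>C = X + X\<^sup>3 (1 + 2 C + X\<^sup>2)\<close>.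
\<close>

section \<open>Permutations avoiding 312 whose cube is the identity\<close>

text \<open>Avoidance is demanded on all naturals, so that it can be applied without tracking
  bounds. By \<open>cube_avoidersI\<close> this is no stronger than avoidance on
  \<open>{1..n}\<close>.\<close>

definition cube_avoiders :: "nat \<Rightarrow> (nat \<Rightarrow> nat) set" where
  "cube_avoiders n = {p. (\<forall>i. i \<notin> {1..n} \<longrightarrow> p i = i) \<and> (\<forall>i. p (p (p i)) = i) \<and>
     (\<forall>i j k. i < j \<longrightarrow> j < k \<longrightarrow> p j < p k \<longrightarrow> \<not> p k < p i)}"

text \<open>These are the sum-indecomposable members: by \<open>avoider_first_block\<close> the
  first summand always ends at the position of the entry 1. For \<open>n = 0\<close> the set is
  empty, because 0 is fixed.\<close>

definition cube_avoiders_conn :: "nat \<Rightarrow> (nat \<Rightarrow> nat) set" where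
  "cube_avoiders_conn n = {p \<in> cube_avoiders n. p n = 1}"

lemma cube_avoidersD:
  assumes "p \<in> cube_avoiders n"
  shows "i \<notin> {1..n} \<Longrightarrow> p i = i" "p (p (p i)) = i"
    "i < j \<Longrightarrow> j < k \<Longrightarrow> p j < p k \<Longrightarrow> p k < p i \<Longrightarrow> False"
    "p i = p j \<longleftrightarrow> i = j" "p i \<in> {1..n} \<longleftrightarrow> i \<in> {1..n}"
proof -
  show out: "i \<notin> {1..n} \<Longrightarrow> p i = i" for i
    using assms by (auto simp: cube_avoiders_def)
  show cube: "p (p (p i)) = i" for i
    using assms by (auto simp: cube_avoiders_def)
  show "i < j \<Longrightarrow> j < k \<Longrightarrow> p j < p k \<Longrightarrow> p k < p i \<Longrightarrow> False"
    using assms unfolding cube_avoiders_def by blast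
  show "p i = p j \<longleftrightarrow> i = j"
    using cube by metis
  show "p i \<in> {1..n} \<longleftrightarrow> i \<in> {1..n}"
    using cube out by metis
qed

lemma cube_avoiders_range:
  assumes "p \<in> cube_avoiders n" "1 \<le> i" "i \<le> n"
  shows "1 \<le> p i" "p i \<le> n"
  using cube_avoidersD(5)[OF assms(1), of i] assms(2,3) by auto

lemma cube_avoiders_0_fixed: "p \<in> cube_avoiders n \<Longrightarrow> p 0 = 0"
  using cube_avoidersD(1) by force

text \<open>An occurrence of 312 cannot leave \<open>{1..n}\<close>: starting at 0 it would need an
  entry below \<open>p 0 = 0\<close>, and ending beyond \<open>n\<close> its last entry would be a
  fixed point larger than every earlier entry.\<close>

lemma cube_avoidersI:
  assumes out: "\<And>i. i \<notin> {1..n} \<Longrightarrow> p i = i"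
    and cube: "\<And>i. 1 \<le> i \<Longrightarrow> i \<le> n \<Longrightarrow> p (p (p i)) = i"
    and avoid: "\<And>i j k. 1 \<le> i \<Longrightarrow> i < j \<Longrightarrow> j < k \<Longrightarrow> k \<le> n \<Longrightarrow>
      p j < p k \<Longrightarrow> p k < p i \<Longrightarrow> False"
  shows "p \<in> cube_avoiders n"
proof -
  have cube': "p (p (p i)) = i" for i
    using cube[of i] out[of i] by (cases "i \<in> {1..n}") auto
  have range: "p i \<in> {1..n}" if "i \<in> {1..n}" for i
    using out[of "p i"] cube'[of i] that by metis
  have "\<not> p k < p i" if "i < j" "j < k" "p j < p k" for i j k
  proof
    assume "p k < p i"
    then have "i \<noteq> 0"
      using out[of 0] by (cases "i = 0") auto
    moreover have "k \<le> n"
    proof (rule ccontr)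
      assume "\<not> k \<le> n"
      then have "p k = k"
        using out by auto
      moreover have "p i \<le> max i n"
        using out[of i] range[of i] by (cases "i \<in> {1..n}") auto
      ultimately show False
        using \<open>p k < p i\<close> \<open>\<not> k \<le> n\<close> that by auto
    qed
    ultimately show False
      using avoid[of i j k] that \<open>p k < p i\<close> by auto
  qed
  then show ?thesis
    using out cube' by (auto simp: cube_avoiders_def)
qed

lemma cube_avoiders_permutes:
  assumes "p \<in> cube_avoiders n"
  shows "p permutes {1..n}"
  unfolding permutes_def using cube_avoidersD(1,2)[OF assms] by metis

lemma finite_cube_avoiders: "finite (cube_avoiders n)"
  by (rule finite_subset[OF _ finite_permutations[of "{1..n}"]])
    (use cube_avoiders_permutes in auto)

lemma finite_cube_avoiders_conn: "finite (cube_avoiders_conn n)"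
  using finite_cube_avoiders[of n] by (simp add: cube_avoiders_conn_def)

section \<open>Splitting off the first summand\<close>

text \<open>An entry before the 1 that exceeds an entry after it would form 312 together with the 1.
  So all entries up to position \<open>k\<close> lie below all later ones, and counting shows that
  they are the values up to \<open>k\<close>.\<close>

lemma avoider_first_block:
  assumes p: "p \<in> cube_avoiders n" and k: "1 \<le> k" "p k = 1"
  shows "i \<le> k \<Longrightarrow> p i \<le> k" "k < i \<Longrightarrow> k < p i"
proof -
  note D = cube_avoidersD[OF p]
  have less: "p i < p j" if "i < k" "k < j" for i j
  proof -
    have "p j \<noteq> 1" "p j \<noteq> 0" "p i \<noteq> p j"
      using D(4)[of j k] D(4)[of j 0] D(4)[of i j] that k cube_avoiders_0_fixed[OF p] by auto
    then show ?thesis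
      using D(3)[of i k j] that k by (cases "p j < p i") auto
  qed
  have less': "p i < p j" if "i \<le> k" "k < j" for i j
  proof (cases "i = k")
    case True
    have "p j \<noteq> 1" "p j \<noteq> 0"
      using D(4)[of j k] D(4)[of j 0] that k cube_avoiders_0_fixed[OF p] by auto
    then show ?thesis
      using True k by auto
  qed (use less that in auto)
  have inj: "inj_on p A" for A
    using D(4) by (auto simp: inj_on_def)
  have le: "p i \<le> k" if "i \<le> k" for i
  proof (rule ccontr)
    assume "\<not> p i \<le> k"
    \<comment> \<open>The value \<open>v\<close> sits at position \<open>p (p v)\<close>. Were that
      position beyond \<open>k\<close>, then \<open>v\<close> would exceed \<open>p i\<close>, which
      is already larger than \<open>k\<close>.\<close>
    have "{..k} \<subseteq> p ` {..k}"
    proof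
      fix v assume "v \<in> {..k}"
      moreover have "p (p (p v)) = v"
        by (rule D(2))
      ultimately show "v \<in> p ` {..k}"
        using less'[OF that, of "p (p v)"] \<open>\<not> p i \<le> k\<close>
        by (intro image_eqI[of _ _ "p (p v)"]) force+
    qed
    moreover have "card (p ` {..k}) = card {..k}"
      using inj by (rule card_image)
    ultimately have "{..k} = p ` {..k}"
      by (intro card_subset_eq) auto
    then show False
      using that \<open>\<not> p i \<le> k\<close> by auto
  qed
  then show "i \<le> k \<Longrightarrow> p i \<le> k" .
  \<comment> \<open>If \<open>p i\<close> were at most \<open>k\<close>, two more applications of
    \<open>p\<close> would stay there and end at \<open>p (p (p i)) = i\<close>.\<close>
  show "k < i \<Longrightarrow> k < p i"
    using le[of "p i"] le[of "p (p i)"] D(2)[of i] by fastforce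
qed

definition perm_dsum :: "nat \<Rightarrow> (nat \<Rightarrow> nat) \<Rightarrow> (nat \<Rightarrow> nat) \<Rightarrow> nat \<Rightarrow> nat" where
  "perm_dsum k q r i = (if i \<le> k then q i else k + r (i - k))"

lemma perm_dsum_in:
  assumes q: "q \<in> cube_avoiders k" and r: "r \<in> cube_avoiders m"
  shows "perm_dsum k q r \<in> cube_avoiders (k + m)"
proof (rule cube_avoidersI)
  note Q = cube_avoidersD[OF q] and R = cube_avoidersD[OF r]
  have q_le: "q i \<le> k" if "i \<le> k" for i
    using Q(5)[of i] that cube_avoiders_0_fixed[OF q] by (cases "i = 0") auto
  have r_pos: "0 < r i" if "0 < i" for i
    using R(4)[of i 0] that cube_avoiders_0_fixed[OF r] by auto
  show "perm_dsum k q r i = i" if "i \<notin> {1..k + m}" for i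
  proof (cases "i = 0")
    case False
    then have "i - k \<notin> {1..m}" "\<not> i \<le> k"
      using that by auto
    then show ?thesis
      using R(1)[of "i - k"] by (simp add: perm_dsum_def)
  qed (use cube_avoiders_0_fixed[OF q] in \<open>simp add: perm_dsum_def\<close>)
  show "perm_dsum k q r (perm_dsum k q r (perm_dsum k q r i)) = i" for i
  proof (cases "i \<le> k")
    case True
    then show ?thesis
      using Q(2)[of i] by (simp add: perm_dsum_def q_le)
  next
    case False
    then show ?thesis
      using R(2)[of "i - k"] r_pos[of "i - k"] r_pos[of "r (i - k)"] by (simp add: perm_dsum_def)
  qed
  show False if h: "i < j" "j < l" "perm_dsum k q r j < perm_dsum k q r l"
    "perm_dsum k q r l < perm_dsum k q r i" for i j l
  proof (cases "l \<le> k")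
    case True
    then show False
      using h Q(3)[of i j l] by (auto simp: perm_dsum_def)
  next
    case False
    \<comment> \<open>The last entry of the occurrence lies in the upper block and the first entry
      exceeds it, so the whole occurrence lies in the upper block.\<close>
    then have "k < i"
      using h q_le[of i] by (auto simp: perm_dsum_def split: if_splits)
    then show False
      using h R(3)[of "i - k" "j - k" "l - k"] by (auto simp: perm_dsum_def diff_less_mono)
  qed
qed

text \<open>Since the cube is the identity, \<open>p (p 1)\<close> is the position of the entry 1.
  The inverse map cuts \<open>p\<close> there, and in a direct sum this position is \<open>k\<close>
  because \<open>q k = 1\<close>.\<close>

lemma cube_avoiders_bij:
  assumes "n \<ge> 1"
  shows "bij_betw (\<lambda>(k, q, r). perm_dsum k q r)
    (SIGMA k:{1..n}. cube_avoiders_conn k \<times> cube_avoiders (n - k)) (cube_avoiders n)"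
proof (rule bij_betw_byWitness[where f' =
      "\<lambda>p. let k = p (p 1) in (k, (\<lambda>i. if i \<le> k then p i else i), (\<lambda>i. p (i + k) - k))"])
  let ?A = "SIGMA k:{1..n}. cube_avoiders_conn k \<times> cube_avoiders (n - k)"
  let ?f = "\<lambda>(k, q, r). perm_dsum k q r"
  let ?g = "\<lambda>p. let k = p (p 1) in
    (k, (\<lambda>i. if i \<le> k then p i else i), (\<lambda>i. p (i + k) - k :: nat))"
  show "\<forall>a\<in>?A. ?g (?f a) = a"
  proof
    fix x assume "x \<in> ?A"
    then obtain k q r where x: "x = (k, q, r)" and "k \<in> {1..n}"
      and q': "q \<in> cube_avoiders_conn k" and r: "r \<in> cube_avoiders (n - k)"
      by auto
    then have k: "1 \<le> k" and q: "q \<in> cube_avoiders k" "q k = 1"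
      by (auto simp: cube_avoiders_conn_def)
    let ?p = "perm_dsum k q r"
    have "q (q 1) = k"
      using cube_avoidersD(2)[OF q(1), of k] q by simp
    then have pp: "?p (?p 1) = k"
      using k cube_avoiders_range[OF q(1), of 1] by (simp add: perm_dsum_def)
    have "(if i \<le> k then ?p i else i) = q i" for i
      using cube_avoidersD(1)[OF q(1), of i] by (auto simp: perm_dsum_def)
    moreover have "?p (i + k) - k = r i" for i
      using q k cube_avoiders_0_fixed[OF r] by (cases "i = 0") (auto simp: perm_dsum_def)
    ultimately show "?g (?f x) = x"
      unfolding x Let_def prod.case pp by simp
  qed
  have key: "?g p \<in> ?A \<and> ?f (?g p) = p" if p: "p \<in> cube_avoiders n" for p
  proof -
    note D = cube_avoidersD[OF p]
    define k where "k = p (p 1)"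
    define q where "q i = (if i \<le> k then p i else i)" for i
    define r where "r i = p (i + k) - k" for i
    have pk: "p k = 1" and k: "1 \<le> k" "k \<le> n"
      using D(2)[of 1] D(5) assms by (auto simp: k_def)
    note blk = avoider_first_block[OF p k(1) pk]
    have p_r: "p (i + k) = r i + k" if "0 < i" for i
      using blk(2)[of "i + k"] that by (simp add: r_def)
    \<comment> \<open>Here \<open>r 0\<close> is \<open>1 - k\<close>, which truncated subtraction
      makes 0 as \<open>k\<close> is at least 1.\<close>
    have r_0: "r 0 = 0"
      using k pk by (simp add: r_def)
    have r_pos: "0 < r i" if "0 < i" for i
      using blk(2)[of "i + k"] that by (simp add: r_def)
    have "q \<in> cube_avoiders k"
    proof (rule cube_avoidersI)
      show "q i = i" if "i \<notin> {1..k}" for i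
        using that cube_avoiders_0_fixed[OF p] by (cases "i = 0") (auto simp: q_def)
      show "q (q (q i)) = i" for i
        using blk(1) D(2)[of i] by (auto simp: q_def)
      show False if "i < j" "j < l" "l \<le> k" "q j < q l" "q l < q i" for i j l
        using D(3)[of i j l] that by (auto simp: q_def)
    qed
    moreover have "q k = 1"
      by (simp add: q_def pk)
    moreover have "r \<in> cube_avoiders (n - k)"
    proof (rule cube_avoidersI)
      show "r i = i" if "i \<notin> {1..n - k}" for i
        using that r_0 D(1)[of "i + k"] by (cases "i = 0") (auto simp: r_def)
      show "r (r (r i)) = i" if "1 \<le> i" for i
        using D(2)[of "i + k"] that p_r[of i] p_r[of "r i"] p_r[of "r (r i)"] r_pos by auto
      show False if "1 \<le> i" "i < j" "j < l" "r j < r l" "r l < r i" for i j l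
        using D(3)[of "i + k" "j + k" "l + k"] that p_r by auto
    qed
    moreover have "perm_dsum k q r = p"
    proof
      show "perm_dsum k q r i = p i" for i
        using p_r[of "i - k"] by (auto simp: perm_dsum_def q_def)
    qed
    moreover have "?g p = (k, q, r)"
      by (simp add: Let_def k_def q_def[abs_def] r_def[abs_def])
    ultimately show ?thesis
      using k by (simp add: cube_avoiders_conn_def)
  qed
  show "\<forall>p\<in>cube_avoiders n. ?f (?g p) = p" "?g ` cube_avoiders n \<subseteq> ?A"
    using key by blast+
  show "?f ` ?A \<subseteq> cube_avoiders n"
  proof safe
    fix k q r
    assume "k \<in> {1..n}" "q \<in> cube_avoiders_conn k" "r \<in> cube_avoiders (n - k)"
    then show "perm_dsum k q r \<in> cube_avoiders n"
      using perm_dsum_in[of q k r "n - k"] by (auto simp: cube_avoiders_conn_def)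
  qed
qed

lemma card_cube_avoiders:
  assumes "n \<ge> 1"
  shows "card (cube_avoiders n) =
    (\<Sum>k=1..n. card (cube_avoiders_conn k) * card (cube_avoiders (n - k)))"
  using bij_betw_same_card[OF cube_avoiders_bij[OF assms]]
  by (simp add: card_SigmaI finite_cube_avoiders finite_cube_avoiders_conn card_cartesian_product)


section \<open>Inserting and deleting the cycle through the first and last points\<close>

text \<open>The first monotonicity condition stops the new entry \<open>a + 2\<close> in front from
  playing the 3 of a 312, the second does so for the new maximum \<open>m + 3\<close> at position
  \<open>a + 2\<close>. Only the second needs the bound \<open>j \<le> m\<close>: fixed points
  beyond \<open>m\<close> exceed \<open>a\<close>, but they form increases.\<close>

definition cycle_insertions :: "nat \<Rightarrow> ((nat \<Rightarrow> nat) \<times> nat) set" where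
  "cycle_insertions m = {(r, a). r \<in> cube_avoiders m \<and> a \<le> m \<and>
     (\<forall>i j. 1 \<le> i \<longrightarrow> i < j \<longrightarrow> r i \<le> a \<longrightarrow> r j \<le> a \<longrightarrow> r j < r i) \<and>
     (\<forall>i j. a < i \<longrightarrow> i < j \<longrightarrow> j \<le> m \<longrightarrow> r j < r i)}"

text \<open>For \<open>a \<le> m\<close> this is the increasing bijection from \<open>{1..m}\<close>
  onto \<open>{1..m + 3}\<close> without the cycle points \<open>1\<close>, \<open>a + 2\<close> and
  \<open>m + 3\<close>. It relabels positions and values alike.\<close>

definition skip_two :: "nat \<Rightarrow> nat \<Rightarrow> nat" where
  "skip_two a i = (if i \<le> a then i + 1 else i + 2)"

definition unskip_two :: "nat \<Rightarrow> nat \<Rightarrow> nat" where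
  "unskip_two a i = (if i \<le> a + 1 then i - 1 else i - 2)"

definition insert_cycle :: "nat \<Rightarrow> (nat \<Rightarrow> nat) \<Rightarrow> nat \<Rightarrow> nat \<Rightarrow> nat" where
  "insert_cycle m r a i =
     (if i = 1 then a + 2 else if i = a + 2 then m + 3 else if i = m + 3 then 1
      else if i \<in> {1..m + 3} then skip_two a (r (unskip_two a i)) else i)"

definition delete_cycle :: "nat \<Rightarrow> (nat \<Rightarrow> nat) \<Rightarrow> nat \<Rightarrow> nat" where
  "delete_cycle m p i =
     (if i \<in> {1..m} then unskip_two (p 1 - 2) (p (skip_two (p 1 - 2) i)) else i)"

lemma unskip_skip_two [simp]: "unskip_two a (skip_two a i) = i"
  by (auto simp: skip_two_def unskip_two_def)

lemma skip_unskip_two: "2 \<le> i \<Longrightarrow> i \<noteq> a + 2 \<Longrightarrow> skip_two a (unskip_two a i) = i"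
  by (auto simp: skip_two_def unskip_two_def)

lemma skip_two_less [simp]: "skip_two a i < skip_two a j \<longleftrightarrow> i < j"
  by (auto simp: skip_two_def)

lemma skip_two_cases:
  assumes "1 \<le> i" "i \<le> m + 3" "a \<le> m"
  obtains "i = 1" | "i = a + 2" | "i = m + 3" | i' where "i = skip_two a i'" "1 \<le> i'" "i' \<le> m"
proof -
  consider "i = 1" | "i = a + 2" | "i = m + 3" | "2 \<le> i" "i \<noteq> a + 2" "i < m + 3"
    using assms by linarith
  then show ?thesis
  proof cases
    case 4
    then have "i = skip_two a (unskip_two a i)" "1 \<le> unskip_two a i" "unskip_two a i \<le> m"
      using assms by (auto simp: skip_unskip_two) (auto simp: unskip_two_def)
    then show ?thesis
      by (rule that(4))
  qed (use that in auto)
qed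

lemma skip_two_bounds:
  assumes "1 \<le> i" "i \<le> m" "a \<le> m"
  shows "2 \<le> skip_two a i" "skip_two a i < m + 3" "skip_two a i \<noteq> a + 2"
  using assms by (auto simp: skip_two_def)

lemma insert_cycle_simps:
  assumes "a \<le> m"
  shows "insert_cycle m r a (Suc 0) = a + 2" "insert_cycle m r a (Suc (Suc a)) = m + 3"
    "insert_cycle m r a (m + 3) = 1"
    "1 \<le> i \<Longrightarrow> i \<le> m \<Longrightarrow> insert_cycle m r a (skip_two a i) = skip_two a (r i)"
  using assms skip_two_bounds[of i m a] by (auto simp: insert_cycle_def)

text \<open>A 312 that uses the new cycle can only use it for its first entry: the maximum
  \<open>m + 3\<close> cannot play the 1 or the 2, the final entry 1 cannot play the 2, and position
  1 can only come first. The remaining cases, first position \<open>1\<close> or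
  \<open>a + 2\<close>, contradict the two conditions of \<open>cycle_insertions\<close>.\<close>

lemma insert_cycle_in:
  assumes "(r, a) \<in> cycle_insertions m"
  shows "insert_cycle m r a \<in> cube_avoiders_conn (m + 3)"
proof -
  let ?p = "insert_cycle m r a"
  have r: "r \<in> cube_avoiders m" and a: "a \<le> m"
    and low: "\<And>i j. 1 \<le> i \<Longrightarrow> i < j \<Longrightarrow> r i \<le> a \<Longrightarrow> r j \<le> a \<Longrightarrow> r j < r i"
    and high: "\<And>i j. a < i \<Longrightarrow> i < j \<Longrightarrow> j \<le> m \<Longrightarrow> r j < r i"
    using assms by (auto simp: cycle_insertions_def)
  note R = cube_avoidersD[OF r] and rng = cube_avoiders_range[OF r]
    and ins = insert_cycle_simps[OF a, where r = r]
  have "?p \<in> cube_avoiders (m + 3)"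
  proof (rule cube_avoidersI)
    show "?p i = i" if "i \<notin> {1..m + 3}" for i
      using that a by (auto simp: insert_cycle_def)
    show "?p (?p (?p i)) = i" if "1 \<le> i" "i \<le> m + 3" for i
      using skip_two_cases[OF that a]
    proof cases
      case (4 i')
      then show ?thesis
        using rng R(2)[of i'] by (simp add: ins)
    qed (simp_all add: ins)
    fix i j k
    assume h: "1 \<le> i" "i < j" "j < k" "k \<le> m + 3" "?p j < ?p k" "?p k < ?p i"
    have up: "?p i \<le> m + 3" if "1 \<le> i" "i \<le> m + 3" for i
      using skip_two_cases[OF that a]
    proof cases
      case (4 i')
      then show ?thesis
        using rng[of i'] skip_two_bounds[of "r i'" m a] a by (simp add: ins)
    qed (use a in \<open>simp_all add: ins\<close>)
    have lo: "1 \<le> ?p i" if "1 \<le> i" "i \<le> m + 3" for i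
      using skip_two_cases[OF that a]
    proof cases
      case (4 i')
      then show ?thesis
        using rng[of i'] skip_two_bounds[of "r i'" m a] a by (simp add: ins)
    qed (use a in \<open>simp_all add: ins\<close>)
    have b: "1 \<le> j" "j \<le> m + 3" "1 \<le> k" "i \<le> m + 3"
      using h by auto
    have "j \<noteq> a + 2"
      using up[of k] h b ins(2) by auto
    moreover have "j \<noteq> 1" "j \<noteq> m + 3"
      using h by auto
    ultimately obtain j' where j': "j = skip_two a j'" "1 \<le> j'" "j' \<le> m"
      using skip_two_cases[OF b(1,2) a] by blast
    have "k \<noteq> m + 3"
      using lo[of j] h b ins(3) by auto
    moreover have "k \<noteq> a + 2"
      using up[of i] h b ins(2) by auto
    moreover have "k \<noteq> 1"
      using h by auto
    ultimately obtain k' where k': "k = skip_two a k'" "1 \<le> k'" "k' \<le> m"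
      using skip_two_cases[OF b(3) h(4) a] by blast
    have jk: "j' < k'" "r j' < r k'"
      using h j' k' by (auto simp: ins)
    show False
      using skip_two_cases[OF h(1) b(4) a]
    proof cases
      case 1
      then have "skip_two a (r k') < a + 2"
        using h k' by (auto simp: ins)
      then have "r k' \<le> a"
        by (auto simp: skip_two_def split: if_splits)
      then show False
        using low[of j' k'] jk j' by auto
    next
      case 2
      then have "a < j'"
        using h j' by (auto simp: skip_two_def split: if_splits)
      then show False
        using high[of j' k'] jk k' by auto
    next
      case 3
      then show False
        using h by auto
    next
      case (4 i')
      then show False
        using h j' k' jk R(3)[of i' j' k'] by (auto simp: ins)
    qed
  qed
  then show ?thesis
    using ins(3) by (simp add: cube_avoiders_conn_def)
qed

lemma delete_insert_cycle:
  assumes "(r, a) \<in> cycle_insertions m"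
  shows "delete_cycle m (insert_cycle m r a) = r"
proof
  fix i
  have r: "r \<in> cube_avoiders m" and a: "a \<le> m"
    using assms by (auto simp: cycle_insertions_def)
  show "delete_cycle m (insert_cycle m r a) i = r i"
    using cube_avoidersD(1)[OF r, of i] insert_cycle_simps[OF a, where r = r] by (auto simp: delete_cycle_def)
qed

text \<open>Applying the cube identity at \<open>n\<close> gives the cycle 1, \<open>p 1\<close>,
  \<open>n\<close>. If two of its points agreed, all three would, which forces
  \<open>n = 1\<close>.\<close>

lemma conn_cycle:
  assumes p: "p \<in> cube_avoiders_conn n" and "n \<ge> 1"
  shows "p n = 1" "p (p 1) = n" "1 \<le> p 1" "p 1 \<le> n" "n \<noteq> 1 \<Longrightarrow> 1 < p 1 \<and> p 1 < n"
proof -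
  have P: "p \<in> cube_avoiders n" and pn: "p n = 1"
    using p by (auto simp: cube_avoiders_conn_def)
  note D = cube_avoidersD[OF P]
  show pp: "p n = 1" "p (p 1) = n"
    using D(2)[of n] pn by auto
  show rng: "1 \<le> p 1" "p 1 \<le> n"
    using cube_avoiders_range[OF P, of 1] assms by auto
  show "1 < p 1 \<and> p 1 < n" if "n \<noteq> 1"
  proof -
    have "p 1 \<noteq> 1" "p 1 \<noteq> n"
      using that D(2)[of 1] pp by auto
    then show ?thesis
      using rng by linarith
  qed
qed

text \<open>The conditions on \<open>(r, a)\<close> are forced: an increase among the values at most
  \<open>a\<close> would form 312 with the first entry \<open>a + 2\<close>, and an increase among
  the positions beyond \<open>a\<close> would form 312 with the maximum at position
  \<open>a + 2\<close>.\<close>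

lemma delete_cycle_in:
  assumes p: "p \<in> cube_avoiders_conn (m + 3)"
  shows "(delete_cycle m p, p 1 - 2) \<in> cycle_insertions m"
    "insert_cycle m (delete_cycle m p) (p 1 - 2) = p"
proof -
  have P: "p \<in> cube_avoiders (m + 3)"
    using p by (simp add: cube_avoiders_conn_def)
  note D = cube_avoidersD[OF P] and rng = cube_avoiders_range[OF P]
  define a where "a = p 1 - 2"
  define r where "r = delete_cycle m p"
  have p1: "p 1 = a + 2" and a: "a \<le> m" and pa: "p (a + 2) = m + 3" and pm: "p (m + 3) = 1"
  proof -
    show "p 1 = a + 2" "a \<le> m" "p (m + 3) = 1"
      using conn_cycle(1,5)[OF p] by (auto simp: a_def)
    then show "p (a + 2) = m + 3"
      using conn_cycle(2)[OF p] by simp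
  qed
  \<comment> \<open>The three cycle points are permuted among themselves, so by injectivity every
    other point is mapped to a non-cycle point.\<close>
  have ex: "\<exists>v. p (skip_two a i) = skip_two a v \<and> 1 \<le> v \<and> v \<le> m" if i: "1 \<le> i" "i \<le> m" for i
  proof -
    let ?s = "skip_two a i"
    note sb = skip_two_bounds[OF i a]
    have "p ?s \<noteq> 1" "p ?s \<noteq> a + 2" "p ?s \<noteq> m + 3"
      using D(4)[of ?s "m + 3"] D(4)[of ?s 1] D(4)[of ?s "a + 2"] sb p1 pa pm by auto
    moreover have "1 \<le> p ?s" "p ?s \<le> m + 3"
      using rng[of ?s] sb by auto
    ultimately show ?thesis
      using skip_two_cases[of "p ?s" m a] a by metis
  qed
  have r_eq: "r i = unskip_two a (p (skip_two a i))" if "1 \<le> i" "i \<le> m" for i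
    using that by (simp add: r_def delete_cycle_def a_def)
  have pr: "p (skip_two a i) = skip_two a (r i)" if i: "1 \<le> i" "i \<le> m" for i
    using ex[OF i] r_eq[OF i] by auto
  have r_rng: "1 \<le> r i" "r i \<le> m" if i: "1 \<le> i" "i \<le> m" for i
    using ex[OF i] r_eq[OF i] by auto
  have r_out: "r i = i" if "i \<notin> {1..m}" for i
    using that unfolding r_def delete_cycle_def by auto
  have r_in: "r \<in> cube_avoiders m"
  proof (rule cube_avoidersI)
    show "r i = i" if "i \<notin> {1..m}" for i
      using that by (rule r_out)
    show "r (r (r i)) = i" if "1 \<le> i" "i \<le> m" for i
    proof -
      have "skip_two a (r (r (r i))) = skip_two a i"
        using D(2)[of "skip_two a i"] pr r_rng that by simp
      then show ?thesis
        by (metis unskip_skip_two)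
    qed
    show False if "1 \<le> i" "i < j" "j < k" "k \<le> m" "r j < r k" "r k < r i" for i j k
      using D(3)[of "skip_two a i" "skip_two a j" "skip_two a k"] that pr by auto
  qed
  have low: "r j < r i" if h: "1 \<le> i" "i < j" "r i \<le> a" "r j \<le> a" for i j
  proof (rule ccontr)
    assume "\<not> r j < r i"
    then have *: "r i < r j"
      using h cube_avoidersD(4)[OF r_in, of i j] by auto
    \<comment> \<open>Beyond \<open>m\<close> the map \<open>r\<close> is the identity, and its
      values there exceed \<open>a\<close>.\<close>
    have jm: "j \<le> m"
      using r_out[of j] h a by (cases "j \<le> m") auto
    have "p (skip_two a i) < p (skip_two a j)"
      using * pr jm h by simp
    moreover have "p (skip_two a j) < p 1"
      using pr[of j] p1 jm h by (simp add: skip_two_def)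
    ultimately show False
      using D(3)[of 1 "skip_two a i" "skip_two a j"] h jm a skip_two_bounds(1)[of i m a] by auto
  qed
  have high: "r j < r i" if h: "a < i" "i < j" "j \<le> m" for i j
  proof (rule ccontr)
    assume "\<not> r j < r i"
    then have *: "r i < r j"
      using h cube_avoidersD(4)[OF r_in, of i j] by auto
    have "p (skip_two a i) < p (skip_two a j)"
      using * pr h by simp
    moreover have "p (skip_two a j) < p (a + 2)"
      using pr[of j] pa h skip_two_bounds(2)[of "r j" m a] a r_rng[of j] by simp
    moreover have "a + 2 < skip_two a i"
      using h by (simp add: skip_two_def)
    ultimately show False
      using D(3)[of "a + 2" "skip_two a i" "skip_two a j"] h by simp
  qed
  show "(delete_cycle m p, p 1 - 2) \<in> cycle_insertions m"
    using r_in a low high unfolding r_def[symmetric] a_def[symmetric] cycle_insertions_def by auto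
  show "insert_cycle m (delete_cycle m p) (p 1 - 2) = p"
    unfolding r_def[symmetric] a_def[symmetric]
  proof
    fix i
    show "insert_cycle m r a i = p i"
    proof (cases "i \<in> {1..m + 3}")
      case True
      then have "1 \<le> i" "i \<le> m + 3"
        by auto
      then show ?thesis
        using a by (cases rule: skip_two_cases)
          (use p1 in \<open>simp_all add: insert_cycle_simps[OF a] pa[simplified] pm pr\<close>)
    next
      case False
      then show ?thesis
        using D(1)[of i] a by (auto simp: insert_cycle_def)
    qed
  qed
qed

lemma card_conn_eq_cycle_insertions:
  "card (cube_avoiders_conn (m + 3)) = card (cycle_insertions m)"
proof -
  have "bij_betw (\<lambda>(r, a). insert_cycle m r a) (cycle_insertions m) (cube_avoiders_conn (m + 3))"
  proof (rule bij_betw_byWitness[where f' = "\<lambda>p. (delete_cycle m p, p 1 - 2)"])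
    show "\<forall>x\<in>cycle_insertions m. (\<lambda>p. (delete_cycle m p, p 1 - 2)) ((\<lambda>(r, a). insert_cycle m r a) x) = x"
      using delete_insert_cycle by (auto simp: insert_cycle_def)
  qed (use insert_cycle_in delete_cycle_in in auto)
  then show ?thesis
    by (simp add: bij_betw_same_card)
qed

section \<open>Counting the admissible insertions\<close>

text \<open>The first entry is \<open>r 1\<close> and the maximum \<open>m\<close> sits at position
  \<open>r 1\<close>. A larger \<open>a\<close> admits the increase from \<open>r 1\<close> to the
  later value \<open>r 1 + 1\<close>; a smaller one admits the increase into the maximum from
  position \<open>r 1 - 1\<close>. Conversely, a forbidden increase would form 312 with the first
  entry or with the maximum.\<close>

lemma conn_insertion_points:
  assumes r: "r \<in> cube_avoiders_conn m" and "m \<ge> 1"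
  shows "(r, a) \<in> cycle_insertions m \<longleftrightarrow> a = r 1 \<or> a = r 1 - 1"
proof -
  have R: "r \<in> cube_avoiders m"
    using r by (simp add: cube_avoiders_conn_def)
  note D = cube_avoidersD[OF R] and rng = cube_avoiders_range[OF R]
  note C = conn_cycle[OF r \<open>m \<ge> 1\<close>]
  show ?thesis
  proof
    assume "(r, a) \<in> cycle_insertions m"
    then have a: "a \<le> m"
      and low: "\<And>i j. 1 \<le> i \<Longrightarrow> i < j \<Longrightarrow> r i \<le> a \<Longrightarrow> r j \<le> a \<Longrightarrow> r j < r i"
      and high: "\<And>i j. a < i \<Longrightarrow> i < j \<Longrightarrow> j \<le> m \<Longrightarrow> r j < r i"
      by (auto simp: cycle_insertions_def)
    have "\<not> r 1 < a"
    proof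
      assume "r 1 < a"
      \<comment> \<open>Since the cube is the identity, \<open>r (r v)\<close> is the position of
        the value \<open>v\<close>; the same device locates values below.\<close>
      define j where "j = r (r (r 1 + 1))"
      have rj: "r j = r 1 + 1"
        using D(2) by (simp add: j_def)
      then have "j \<noteq> 1" "j \<noteq> 0"
        using cube_avoiders_0_fixed[OF R] by (metis n_not_Suc_n Suc_eq_plus1, metis Suc_eq_plus1 old.nat.distinct(1))
      then show False
        using low[of 1 j] rj \<open>r 1 < a\<close> by auto
    qed
    moreover have "\<not> a < r 1 - 1"
    proof
      assume "a < r 1 - 1"
      then have "r (r 1) < r (r 1 - 1)"
        using high[of "r 1 - 1" "r 1"] C by auto
      then show False
        using C(2,4) rng(2)[of "r 1 - 1"] \<open>a < r 1 - 1\<close> by linarith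
    qed
    ultimately show "a = r 1 \<or> a = r 1 - 1"
      by linarith
  next
    assume a: "a = r 1 \<or> a = r 1 - 1"
    have low: "r j < r i" if h: "1 \<le> i" "i < j" "r j \<le> r 1" for i j
    proof (rule ccontr)
      assume "\<not> r j < r i"
      then have *: "r i < r j"
        using h D(4)[of i j] by auto
      moreover have "r j \<noteq> r 1"
        using D(4)[of j 1] h by auto
      ultimately show False
        using D(3)[of 1 i j] h by (cases "i = 1") auto
    qed
    have high: "r j < r i" if h: "r 1 \<le> i" "i < j" "j \<le> m" for i j
    proof (rule ccontr)
      assume "\<not> r j < r i"
      then have *: "r i < r j"
        using h D(4)[of i j] by auto
      moreover have "r j \<le> m"
        using rng[of j] h C by auto
      moreover have "r j \<noteq> m"
        using D(4)[of j "r 1"] C h by auto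
      ultimately show False
        using D(3)[of "r 1" i j] h C by (cases "i = r 1") auto
    qed
    show "(r, a) \<in> cycle_insertions m"
      using R a C low high by (auto simp: cycle_insertions_def)
  qed
qed

text \<open>Let \<open>k < m\<close> be the position of the entry 1. If \<open>a < k\<close>, the
  entry 1 and the last entry form an increase beyond \<open>a\<close>; if \<open>k < a\<close>, the
  entry 1 is followed by the value \<open>k + 1\<close>. So \<open>a = k\<close>, both blocks are
  decreasing, and the cube identity shrinks each to a single point.\<close>

lemma disconn_insertions:
  assumes "(r, a) \<in> cycle_insertions m" "m \<ge> 1" "r \<notin> cube_avoiders_conn m"
  shows "m = 2" "r = id" "a = 1"
proof -
  have R: "r \<in> cube_avoiders m" and a: "a \<le> m"
    and low: "\<And>i j. 1 \<le> i \<Longrightarrow> i < j \<Longrightarrow> r i \<le> a \<Longrightarrow> r j \<le> a \<Longrightarrow> r j < r i"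
    and high: "\<And>i j. a < i \<Longrightarrow> i < j \<Longrightarrow> j \<le> m \<Longrightarrow> r j < r i"
    using assms(1) by (auto simp: cycle_insertions_def)
  note D = cube_avoidersD[OF R] and rng = cube_avoiders_range[OF R]
  define k where "k = r (r 1)"
  have rk: "r k = 1"
    using D(2) by (simp add: k_def)
  have k: "1 \<le> k" "k < m"
  proof -
    have "1 \<le> k" "k \<le> m"
      using rng[of 1] rng[of "r 1"] assms(2) by (auto simp: k_def)
    moreover have "k \<noteq> m"
      using assms(3) R rk by (auto simp: cube_avoiders_conn_def)
    ultimately show "1 \<le> k" "k < m"
      by auto
  qed
  note blk = avoider_first_block[OF R k(1) rk]
  have "\<not> a < k"
    using high[of k m] rk rng[of m] k by auto
  moreover have "\<not> k < a"
  proof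
    assume "k < a"
    define j where "j = r (r (k + 1))"
    have rj: "r j = k + 1"
      using D(2) by (simp add: j_def)
    then have "k < j"
      using blk(1)[of j] by fastforce
    then show False
      using low[of k j] rj rk k \<open>k < a\<close> by auto
  qed
  ultimately have ak: "a = k"
    by simp
  have "r 1 = k"
  proof (rule ccontr)
    assume "r 1 \<noteq> k"
    define i where "i = r (r k)"
    have ri: "r i = k"
      using D(2) by (simp add: i_def)
    then have "i \<noteq> 1" "i \<noteq> 0"
      using \<open>r 1 \<noteq> k\<close> k cube_avoiders_0_fixed[OF R] by (metis, metis not_one_le_zero)
    then have "r i < r 1"
      using low[of 1 i] ri ak blk(1)[of 1] k by auto
    then show False
      using ri blk(1)[of 1] k by auto
  qed
  \<comment> \<open>Otherwise 1 and \<open>k\<close> would be swapped, which the cube identity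
    excludes.\<close>
  then have k1: "k = 1"
    using D(2)[of 1] rk by simp
  then have r1: "r 1 = 1"
    using rk by simp
  have "r 2 = m"
  proof (rule ccontr)
    assume "r 2 \<noteq> m"
    define i where "i = r (r m)"
    have ri: "r i = m" and "1 \<le> i" "i \<le> m"
      using D(2) rng[of m] rng[of "r m"] k by (auto simp: i_def)
    moreover have "i \<noteq> 1" "i \<noteq> 2"
      using \<open>r 2 \<noteq> m\<close> ri r1 k k1 by auto
    ultimately have "r i < r 2"
      using high[of 2 i] ak k1 by auto
    then show False
      using ri rng[of 2] k k1 by auto
  qed
  moreover have "r m = 2"
  proof (rule ccontr)
    assume "r m \<noteq> 2"
    define i where "i = r (r 2)"
    have ri: "r i = 2" and "1 \<le> i" "i \<le> m"
      using D(2) rng[of 2] rng[of "r 2"] k k1 by (auto simp: i_def)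
    moreover have "i \<noteq> 1" "i \<noteq> m"
      using \<open>r m \<noteq> 2\<close> ri r1 by auto
    ultimately have "r m < r i"
      using high[of i m] ak k1 by auto
    moreover have "r m \<noteq> 1" "1 \<le> r m"
      using D(4)[of m 1] r1 rng[of m] k k1 by auto
    ultimately show False
      using ri by auto
  qed
  \<comment> \<open>Likewise 2 and \<open>m\<close> are interchanged, so they coincide.\<close>
  ultimately show m: "m = 2"
    using D(2)[of 2] by simp
  show "a = 1"
    using ak k1 by simp
  show "r = id"
  proof
    fix i
    show "r i = id i"
      using D(1)[of i] r1 \<open>r 2 = m\<close> m by (cases "i = 1"; cases "i = 2") auto
  qed
qed

lemma id_cube_avoider: "id \<in> cube_avoiders n"
  by (rule cube_avoidersI) auto

lemma cube_avoiders_0: "cube_avoiders 0 = {id}"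
  using id_cube_avoider[of 0] by (auto simp: cube_avoiders_def)

lemma conn_0: "cube_avoiders_conn 0 = {}"
  by (auto simp: cube_avoiders_conn_def cube_avoiders_0)

lemma conn_1: "cube_avoiders_conn 1 = {id}"
proof -
  have "p = id" if "p \<in> cube_avoiders_conn 1" for p
  proof
    fix i
    have "p \<in> cube_avoiders 1" "p 1 = 1"
      using that by (auto simp: cube_avoiders_conn_def)
    then show "p i = id i"
      using cube_avoidersD(1)[of p 1 i] by (cases "i = 1") auto
  qed
  then show ?thesis
    using id_cube_avoider[of 1] by (auto simp: cube_avoiders_conn_def)
qed

lemma conn_2: "cube_avoiders_conn 2 = {}"
  using conn_cycle(5)[of _ 2] by fastforce

lemma card_cycle_insertions:
  "card (cycle_insertions m) =
     (if m = 0 then 1 else 0) + 2 * card (cube_avoiders_conn m) + (if m = 2 then 1 else 0)"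
proof (cases "m = 0")
  case True
  then have "cycle_insertions m = {(id, 0)}"
    using id_cube_avoider[of 0] by (auto simp: cycle_insertions_def cube_avoiders_0)
  then show ?thesis
    using True by (simp add: conn_0)
next
  case False
  let ?C = "cube_avoiders_conn m"
  define E where "E = (if m = 2 then {(id :: nat \<Rightarrow> nat, 1 :: nat)} else {})"
  define S where "S = (SIGMA r:?C. {r 1, r 1 - 1})"
  have E_sub: "E \<subseteq> cycle_insertions m"
    using id_cube_avoider[of 2] by (auto simp: E_def cycle_insertions_def)
  have S_E: "x \<in> S \<union> E" if x: "x \<in> cycle_insertions m" for x
  proof (cases x)
    case (Pair r a)
    show ?thesis
    proof (cases "r \<in> ?C")
      case True
      then show ?thesis
        using conn_insertion_points[of r m a] False x Pair by (auto simp: S_def)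
    next
      case not: False
      then show ?thesis
        using disconn_insertions[of r a m] False x Pair by (auto simp: E_def)
    qed
  qed
  have S_sub: "S \<subseteq> cycle_insertions m"
    using conn_insertion_points False by (auto simp: S_def)
  have "cycle_insertions m = S \<union> E"
    using S_E S_sub E_sub by blast
  \<comment> \<open>The exceptional pair exists only in size 2, where no indecomposable avoider
    exists.\<close>
  moreover have "S \<inter> E = {}"
    by (auto simp: S_def E_def conn_2)
  \<comment> \<open>As \<open>r 1\<close> is at least 1, truncated subtraction does not merge the
    two choices.\<close>
  moreover have "card {r 1, r 1 - 1} = 2" if "r \<in> ?C" for r
    using conn_cycle(3)[OF that] False by (auto simp: card_insert_if)
  then have "card S = 2 * card ?C"
    by (simp add: S_def card_SigmaI finite_cube_avoiders_conn)
  moreover have "finite S" "finite E" "card E = (if m = 2 then 1 else 0)"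
    by (auto simp: S_def E_def finite_cube_avoiders_conn)
  ultimately show ?thesis
    using False by (simp add: card_Un_disjoint)
qed

section \<open>Translation to \<open>Omega\<close> and exchange of the two patterns\<close>

text \<open>Replaces the position function of an occurrence by three explicit positions. Keeping
  \<open>w\<close> general serves both patterns at once.\<close>

lemma avoids_iff:
  assumes "length w = 3"
  shows "avoids n p 3 (perm_of_word w) \<longleftrightarrow>
    \<not> (\<exists>i j k. 1 \<le> i \<and> i < j \<and> j < k \<and> k \<le> n \<and>
        (\<forall>(x, u)\<in>{(i, w ! 0), (j, w ! 1), (k, w ! 2)}.
          \<forall>(y, v)\<in>{(i, w ! 0), (j, w ! 1), (k, w ! 2)}. p x < p y \<longleftrightarrow> u < v))"
proof -
  have I: "{1..3} = {1, 2, 3 :: nat}"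
    by auto
  have W: "perm_of_word w 1 = w ! 0" "perm_of_word w 2 = w ! 1" "perm_of_word w 3 = w ! 2"
    using assms by (auto simp: perm_of_word_def)
  have "(\<exists>f. is_occurrence n p 3 (perm_of_word w) f) \<longleftrightarrow>
    (\<exists>i j k. 1 \<le> i \<and> i < j \<and> j < k \<and> k \<le> n \<and>
        (\<forall>(x, u)\<in>{(i, w ! 0), (j, w ! 1), (k, w ! 2)}.
          \<forall>(y, v)\<in>{(i, w ! 0), (j, w ! 1), (k, w ! 2)}. p x < p y \<longleftrightarrow> u < v))" (is "?L \<longleftrightarrow> ?R")
  proof
    assume ?L
    then obtain f where f: "is_occurrence n p 3 (perm_of_word w) f"
      by blast
    show ?R
      by (rule exI[of _ "f 1"], rule exI[of _ "f 2"], rule exI[of _ "f 3"])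
        (use f in \<open>unfold is_occurrence_def strict_mono_on_def I, simp add: W[simplified]\<close>)
  next
    assume ?R
    then obtain i j k where h: "1 \<le> i" "i < j" "j < k" "k \<le> n"
      "\<forall>(x, u)\<in>{(i, w ! 0), (j, w ! 1), (k, w ! 2)}.
          \<forall>(y, v)\<in>{(i, w ! 0), (j, w ! 1), (k, w ! 2)}. p x < p y \<longleftrightarrow> u < v"
      by blast
    show ?L
      by (rule exI[of _ "\<lambda>x. if x = 1 then i else if x = 2 then j else k"])
        (use h in \<open>unfold is_occurrence_def strict_mono_on_def I, auto simp: W[simplified]\<close>)
  qed
  then show ?thesis
    by (simp add: avoids_def)
qed

lemma avoids_312_iff:
  "avoids n p 3 (perm_of_word [3, 1, 2]) \<longleftrightarrow>
    (\<forall>i j k. 1 \<le> i \<longrightarrow> i < j \<longrightarrow> j < k \<longrightarrow> k \<le> n \<longrightarrow> \<not> (p j < p k \<and> p k < p i))"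
proof -
  let ?w = "[3, 1, 2] :: nat list"
  have "(\<forall>(x, u)\<in>{(i, ?w ! 0), (j, ?w ! 1), (k, ?w ! 2)}.
      \<forall>(y, v)\<in>{(i, ?w ! 0), (j, ?w ! 1), (k, ?w ! 2)}. p x < p y \<longleftrightarrow> u < v) \<longleftrightarrow>
    p j < p k \<and> p k < p i" for i j k
    by auto
  then show ?thesis
    by (subst avoids_iff) auto
qed

lemma avoids_231_iff:
  "avoids n p 3 (perm_of_word [2, 3, 1]) \<longleftrightarrow>
    (\<forall>i j k. 1 \<le> i \<longrightarrow> i < j \<longrightarrow> j < k \<longrightarrow> k \<le> n \<longrightarrow> \<not> (p k < p i \<and> p i < p j))"
proof -
  let ?w = "[2, 3, 1] :: nat list"
  have "(\<forall>(x, u)\<in>{(i, ?w ! 0), (j, ?w ! 1), (k, ?w ! 2)}.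
      \<forall>(y, v)\<in>{(i, ?w ! 0), (j, ?w ! 1), (k, ?w ! 2)}. p x < p y \<longleftrightarrow> u < v) \<longleftrightarrow>
    p k < p i \<and> p i < p j" for i j k
    by auto
  then show ?thesis
    by (subst avoids_iff) auto
qed

text \<open>As 3 is prime, having order 1 or 3 means having order dividing 3, that is, trivial
  cube.\<close>

lemma sym_group_ord_1_3_iff:
  assumes "p permutes {1..n}"
  shows "group.ord (sym_group n) p \<in> {1, 3} \<longleftrightarrow> (\<forall>i. p (p (p i)) = i)"
proof -
  interpret group "sym_group n"
    by (rule sym_group_is_group)
  have p: "p \<in> carrier (sym_group n)"
    using assms by (simp add: sym_group_carrier)
  have "ord p \<in> {1, 3} \<longleftrightarrow> ord p dvd 3"
    using prime_nat_iff[of 3] by auto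
  also have "\<dots> \<longleftrightarrow> p [^]\<^bsub>sym_group n\<^esub> (3 :: nat) = \<one>\<^bsub>sym_group n\<^esub>"
    using pow_eq_id[OF p, of 3] by simp
  also have "p [^]\<^bsub>sym_group n\<^esub> (3 :: nat) = p \<circ> p \<circ> p"
    using p by (simp add: numeral_3_eq_3 sym_group_def)
  finally show ?thesis
    by (auto simp: sym_group_def fun_eq_iff)
qed

lemma Omega_iff:
  assumes "length w = 3"
  shows "p \<in> Omega {1, 3} n w \<longleftrightarrow>
    p permutes {1..n} \<and> avoids n p 3 (perm_of_word w) \<and> (\<forall>i. p (p (p i)) = i)"
  using assms sym_group_ord_1_3_iff[of p n] by (auto simp: Omega_def sym_group_carrier)

lemma Omega_312: "Omega {1, 3} n [3, 1, 2] = cube_avoiders n"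
proof (intro equalityI subsetI)
  fix p assume "p \<in> Omega {1, 3} n [3, 1, 2]"
  then have p: "p permutes {1..n}" "avoids n p 3 (perm_of_word [3, 1, 2])" "\<forall>i. p (p (p i)) = i"
    by (simp_all add: Omega_iff del: One_nat_def)
  show "p \<in> cube_avoiders n"
  proof (rule cube_avoidersI)
    show "p i = i" if "i \<notin> {1..n}" for i
      using permutes_not_in[OF p(1) that] .
    show "p (p (p i)) = i" for i
      using p(3) by simp
    show False if "1 \<le> i" "i < j" "j < k" "k \<le> n" "p j < p k" "p k < p i" for i j k
      using p(2) that unfolding avoids_312_iff by blast
  qed
next
  fix p assume p: "p \<in> cube_avoiders n"
  have "avoids n p 3 (perm_of_word [3, 1, 2])"
    unfolding avoids_312_iff using cube_avoidersD(3)[OF p] by blast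
  then show "p \<in> Omega {1, 3} n [3, 1, 2]"
    using cube_avoiders_permutes[OF p] cube_avoidersD(2)[OF p]
    by (simp add: Omega_iff del: One_nat_def)
qed

text \<open>When the cube is the identity, squaring is inversion, hence an involution on such
  permutations, and inversion turns occurrences of 312 into occurrences of 231.\<close>

lemma card_Omega_231: "card (Omega {1, 3} n [2, 3, 1]) = card (cube_avoiders n)"
proof -
  have "bij_betw (\<lambda>p i. p (p i)) (Omega {1, 3} n [2, 3, 1]) (cube_avoiders n)"
  proof (rule bij_betw_byWitness[where f' = "\<lambda>p i. p (p i)"])
    show "\<forall>p\<in>Omega {1, 3} n [2, 3, 1]. (\<lambda>i. p (p (p (p i)))) = p"
      by (simp add: Omega_iff del: One_nat_def)
    show "\<forall>p\<in>cube_avoiders n. (\<lambda>i. p (p (p (p i)))) = p"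
      using cube_avoidersD(2) by auto
    show "(\<lambda>p i. p (p i)) ` Omega {1, 3} n [2, 3, 1] \<subseteq> cube_avoiders n"
    proof safe
      fix p assume "p \<in> Omega {1, 3} n [2, 3, 1]"
      then have p: "p permutes {1..n}" "avoids n p 3 (perm_of_word [2, 3, 1])"
        and cube: "\<And>i. p (p (p i)) = i"
        by (simp_all add: Omega_iff del: One_nat_def)
      show "(\<lambda>i. p (p i)) \<in> cube_avoiders n"
      proof (rule cube_avoidersI)
        show "p (p i) = i" if "i \<notin> {1..n}" for i
          using permutes_not_in[OF p(1) that] by simp
        show "p (p (p (p (p (p i))))) = i" for i
          by (simp add: cube)
        show False if h: "1 \<le> i" "i < j" "j < k" "k \<le> n" "p (p j) < p (p k)" "p (p k) < p (p i)"
          for i j k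
        proof -
          \<comment> \<open>The increasing positions \<open>p (p j)\<close>, \<open>p (p k)\<close>,
            \<open>p (p i)\<close> carry the values \<open>j\<close>, \<open>k\<close>,
            \<open>i\<close> under \<open>p\<close>, which is an occurrence of 231.\<close>
          have "p (p j) \<in> {1..n}" "p (p i) \<in> {1..n}"
            unfolding permutes_in_image[OF p(1)] using h by auto
          then show False
            using p(2) h cube unfolding avoids_231_iff by (metis atLeastAtMost_iff)
        qed
      qed
    qed
    show "(\<lambda>p i. p (p i)) ` cube_avoiders n \<subseteq> Omega {1, 3} n [2, 3, 1]"
    proof safe
      fix p assume p: "p \<in> cube_avoiders n"
      note D = cube_avoidersD[OF p]
      have "(\<lambda>i. p (p i)) permutes {1..n}"
        using permutes_compose[OF cube_avoiders_permutes[OF p] cube_avoiders_permutes[OF p]]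
        by (simp add: comp_def)
      moreover have "avoids n (\<lambda>i. p (p i)) 3 (perm_of_word [2, 3, 1])"
        unfolding avoids_231_iff using D(2,3) by metis
      ultimately show "(\<lambda>i. p (p i)) \<in> Omega {1, 3} n [2, 3, 1]"
        by (simp add: Omega_iff D(2) del: One_nat_def)
    qed
  qed
  then show ?thesis
    by (rule bij_betw_same_card)
qed

section \<open>Generating functions\<close>

lemma gen_fun_cube_avoiders:
  "gen_fun (\<lambda>n. card (cube_avoiders n)) =
     (fps_X + fps_X ^ 3 + fps_X ^ 5) / (1 - fps_X - 3 * fps_X ^ 3 - fps_X ^ 5)"
proof -
  define G where "G = gen_fun (\<lambda>n. card (cube_avoiders n))"
  define C :: "rat fps" where "C = Abs_fps (\<lambda>n. of_nat (card (cube_avoiders_conn n)))"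
  let ?X = "fps_X :: rat fps"
  let ?D = "1 - ?X - 3 * ?X ^ 3 - ?X ^ 5"
  \<comment> \<open>Adding 1 restores the empty permutation, which the convolution needs as a
    possible second summand.\<close>
  have G1: "1 + G = Abs_fps (\<lambda>n. of_nat (card (cube_avoiders n)))"
  proof (rule fps_ext)
    show "fps_nth (1 + G) n = fps_nth (Abs_fps (\<lambda>n. of_nat (card (cube_avoiders n)))) n" for n
      by (cases n) (simp_all add: G_def gen_fun_def cube_avoiders_0)
  qed
  have GC: "1 + G = 1 + C * (1 + G)"
  proof (rule fps_ext)
    fix n
    show "fps_nth (1 + G) n = fps_nth (1 + C * (1 + G)) n"
    proof (cases "n = 0")
      case True
      then show ?thesis
        unfolding G1 by (simp add: C_def cube_avoiders_0 conn_0)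
    next
      case False
      have "{0..n} = insert 0 {1..n}"
        by auto
      then show ?thesis
        unfolding G1 using False card_cube_avoiders[of n]
        by (simp add: C_def fps_mult_nth conn_0)
    qed
  qed
  have C: "C = ?X + ?X ^ 3 * (1 + 2 * C + ?X ^ 2)"
  proof (rule fps_ext)
    fix n
    show "fps_nth C n = fps_nth (?X + ?X ^ 3 * (1 + 2 * C + ?X ^ 2)) n"
    \<comment> \<open>Cycle insertion only produces sizes from 3 on; the smaller sizes contribute
      just the term \<open>?X\<close>, for the single point.\<close>
    proof (cases "n < 3")
      case True
      then consider "n = 0" | "n = 1" | "n = 2"
        by linarith
      then show ?thesis
        by cases (use conn_0 conn_1 conn_2 in \<open>simp_all add: C_def fps_X_power_mult_nth\<close>)
    next
      case False
      then obtain m where n: "n = m + 3"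
        by (metis add.commute le_add_diff_inverse not_less)
      have "fps_nth C n = (if m = 0 then 1 else 0) + 2 * fps_nth C m + (if m = 2 then 1 else 0)"
        unfolding n C_def by (simp only: fps_nth_Abs_fps card_conn_eq_cycle_insertions card_cycle_insertions) simp
      also have "\<dots> = fps_nth (?X + ?X ^ 3 * (1 + 2 * C + ?X ^ 2)) n"
        by (simp add: n fps_X_power_mult_nth fps_X_power_nth numeral_fps_const)
      finally show ?thesis .
    qed
  qed
  have "G * ?D = ?X + ?X ^ 3 + ?X ^ 5"
  proof -
    define N where "N = ?X + ?X ^ 3 + ?X ^ 5"
    have G: "G * (1 - C) = C"
      using GC by (simp add: algebra_simps)
    have "?X ^ 3 * ?X ^ 2 = ?X ^ 5"
      by (simp flip: power_add)
    then have N: "(1 - 2 * ?X ^ 3) * C = N"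
      using C by (simp add: N_def algebra_simps)
    \<comment> \<open>With \<open>N = (1 - 2 * ?X ^ 3) * C\<close> the denominator becomes
      \<open>(1 - 2 * ?X ^ 3) * (1 - C)\<close>, so that \<open>G * (1 - C) = C\<close>
      applies.\<close>
    have "G * ?D = G * ((1 - 2 * ?X ^ 3) - N)"
      by (simp add: N_def algebra_simps)
    also have "\<dots> = (1 - 2 * ?X ^ 3) * (G * (1 - C))"
      unfolding N[symmetric] by (simp add: algebra_simps)
    finally show ?thesis
      unfolding G N N_def .
  qed
  moreover have "fps_nth ?D 0 = 1"
    by simp
  then have "?D \<noteq> 0"
    by (metis fps_zero_nth zero_neq_one)
  ultimately show ?thesis
    unfolding G_def[symmetric] by (metis nonzero_mult_div_cancel_right)
qed

theorem theorem1p2: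
  shows "gen_fun (\<lambda>n. card (Omega {1, 3} n [2, 3, 1])) =
           gen_fun (\<lambda>n. card (Omega {1, 3} n [3, 1, 2])) \<and>
         gen_fun (\<lambda>n. card (Omega {1, 3} n [3, 1, 2])) =
           (fps_X + fps_X ^ 3 + fps_X ^ 5) / (1 - fps_X - 3 * fps_X ^ 3 - fps_X ^ 5)"
  by (simp only: Omega_312 card_Omega_231 gen_fun_cube_avoiders)

end
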